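(* Let $X\subseteq\mathbb{C}$ and let $f,g:X\times X\to\mathbb{C}$ be functions such that $f\perp g$ and $g(x,y)=-g(y,x)$ for all $x,y\in X$. Let $\{x_n\}_{n\ge0},\{a_n\}_{n\ge0},\{b_n\}_{n\ge0},\{c_n\}_{n\ge0},\{d_n\}_{n\ge0}$ be sequences in $X$ such that for each $n$ the elements $x_n,a_n,b_n,c_n,d_n$ are pairwise distinct, and such that all denominators occurring below are nonzero. Put $$U_n:=\prod_{k=0}^n\frac{f(x_k,b_k)^{2}\,g(a_k,c_k)\,g(a_k,d_k)}{f(x_k,a_k)^{2}\,g(b_k,c_k)\,g(b_k,d_k)},$$ $$T_1(n):=\sum^{n}_{k=1}\frac{f(x_k,d_k)^2\,g(a_k,b_k)\,g(a_k,c_k)}{f(x_k,a_k)^{2}\,g(d_k,b_k)\,g(d_k,c_k)}\,U_{k-1},$$ $$T_2(n):=\sum^{n}_{k=1}\frac{f(x_k,c_k)^{2}\,g(a_k,b_k)\,g(a_k,d_k)}{f(x_k,a_k)^{2}\,g(c_k,b_k)\,g(c_k,d_k)}\,U_{k-1}.$$ Then for every integer $n\ge 0$, $$T_1(n)+T_2(n)=U_0-U_n.$$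
   Context: For functions $f,g:X\times X\to\mathbb{C}$, the notation $f\perp g$ means that for all $x,a,b,c\in X$ (Jacobi's identity) $$f(x,a)g(b,c)+f(x,b)g(c,a)+f(x,c)g(a,b)=0.$$ Empty sums equal $0$. *)

theory Defs
  imports Complex_Main
begin

text \<open>Functions on \<open>X \<times> X\<close> are represented by total curried functions; only their
  values at points of \<open>X\<close> are ever constrained or used.\<close>

definition jacobi_perp ::
  "complex set \<Rightarrow> (complex \<Rightarrow> complex \<Rightarrow> complex) \<Rightarrow> (complex \<Rightarrow> complex \<Rightarrow> complex) \<Rightarrow> bool"
where
  "jacobi_perp X f g \<longleftrightarrow>
     (\<forall>x\<in>X. \<forall>a\<in>X. \<forall>b\<in>X. \<forall>c\<in>X. f x a * g b c + f x b * g c a + f x c * g a b = 0)"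

definition U ::
  "(complex \<Rightarrow> complex \<Rightarrow> complex) \<Rightarrow> (complex \<Rightarrow> complex \<Rightarrow> complex) \<Rightarrow>
   (nat \<Rightarrow> complex) \<Rightarrow> (nat \<Rightarrow> complex) \<Rightarrow> (nat \<Rightarrow> complex) \<Rightarrow> (nat \<Rightarrow> complex) \<Rightarrow>
   (nat \<Rightarrow> complex) \<Rightarrow> nat \<Rightarrow> complex"
where
  "U f g x a b c d n =
     (\<Prod>k=0..n. (f (x k) (b k))\<^sup>2 * g (a k) (c k) * g (a k) (d k)
               / ((f (x k) (a k))\<^sup>2 * g (b k) (c k) * g (b k) (d k)))"

definition T1 ::
  "(complex \<Rightarrow> complex \<Rightarrow> complex) \<Rightarrow> (complex \<Rightarrow> complex \<Rightarrow> complex) \<Rightarrow>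
   (nat \<Rightarrow> complex) \<Rightarrow> (nat \<Rightarrow> complex) \<Rightarrow> (nat \<Rightarrow> complex) \<Rightarrow> (nat \<Rightarrow> complex) \<Rightarrow>
   (nat \<Rightarrow> complex) \<Rightarrow> nat \<Rightarrow> complex"
where
  "T1 f g x a b c d n =
     (\<Sum>k=1..n. (f (x k) (d k))\<^sup>2 * g (a k) (b k) * g (a k) (c k)
               / ((f (x k) (a k))\<^sup>2 * g (d k) (b k) * g (d k) (c k))
               * U f g x a b c d (k - 1))"

definition T2 ::
  "(complex \<Rightarrow> complex \<Rightarrow> complex) \<Rightarrow> (complex \<Rightarrow> complex \<Rightarrow> complex) \<Rightarrow>
   (nat \<Rightarrow> complex) \<Rightarrow> (nat \<Rightarrow> complex) \<Rightarrow> (nat \<Rightarrow> complex) \<Rightarrow> (nat \<Rightarrow> complex) \<Rightarrow>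
   (nat \<Rightarrow> complex) \<Rightarrow> nat \<Rightarrow> complex"
where
  "T2 f g x a b c d n =
     (\<Sum>k=1..n. (f (x k) (c k))\<^sup>2 * g (a k) (b k) * g (a k) (d k)
               / ((f (x k) (a k))\<^sup>2 * g (c k) (b k) * g (c k) (d k))
               * U f g x a b c d (k - 1))"

end

theory Submission
  imports Defs
begin

text \<open>The identity telescopes. Write \<open>B k\<close>, \<open>D k\<close> and \<open>C k\<close> for the \<open>k\<close>-th factor of \<open>U\<close> and
  for the coefficients of \<open>U (k - 1)\<close> in \<open>T1\<close> and \<open>T2\<close>. Since \<open>U k = B k * U (k - 1)\<close>, the
  \<open>k\<close>-th summands of \<open>T1\<close> and \<open>T2\<close> together equal \<open>U (k - 1) - U k\<close> as soon as
  \<open>B k + C k + D k = 1\<close>. This last identity involves one index only.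

  To see why it holds, consider the model case \<open>f u v = u - v\<close> and \<open>g = f\<close>: it is the Lagrange
  interpolation formula at the nodes \<open>b, c, d\<close> for the quadratic polynomial \<open>(x - t)\<^sup>2\<close> in \<open>t\<close>,
  evaluated at \<open>t = a\<close> and divided by \<open>(x - a)\<^sup>2\<close>. In general the Jacobi identity says that
  any three of the values \<open>f x a, f x b, f x c, f x d\<close> satisfy a linear relation with
  coefficients given by \<open>g\<close>, and these relations replace the interpolation argument. They
  reduce the claim to the Pluecker relation among the six values of \<open>g\<close> on pairs from
  \<open>a, b, c, d\<close>, that is, to a Jacobi identity of \<open>g\<close> with itself
  (\<open>plucker_of_jacobi\<close>, \<open>quadratic_interpolation\<close>).\<close>

text \<open>After multiplication by \<open>f x a\<close>, each of \<open>g c d\<close>, \<open>g b d\<close>, \<open>g b c\<close> becomes a combination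
  of the values \<open>g a b\<close>, \<open>g a c\<close>, \<open>g a d\<close>, and the resulting terms cancel in pairs. So \<open>g\<close>
  satisfies the Jacobi identity with itself at every point \<open>a\<close> where some \<open>f x a\<close> is nonzero.\<close>

lemma plucker_of_jacobi:
  fixes f g :: "complex \<Rightarrow> complex \<Rightarrow> complex"
  assumes perp: "jacobi_perp X f g"
    and anti: "\<And>u v. u \<in> X \<Longrightarrow> v \<in> X \<Longrightarrow> g u v = - g v u"
    and X: "x \<in> X" "a \<in> X" "b \<in> X" "c \<in> X" "d \<in> X"
    and nz: "f x a \<noteq> 0"
  shows "g a b * g c d - g a c * g b d + g a d * g b c = 0"
proof -
  have rel: "f x a * g u v = f x u * g a v - f x v * g a u" if "u \<in> X" "v \<in> X" for u v
  proof -
    have "f x a * g u v + f x u * g v a + f x v * g a u = 0"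
      using perp X that unfolding jacobi_perp_def by blast
    moreover have "g v a = - g a v" using anti X that by blast
    ultimately show ?thesis by (simp add: algebra_simps add_eq_0_iff)
  qed
  have "f x a * (g a b * g c d - g a c * g b d + g a d * g b c)
      = g a b * (f x a * g c d) - g a c * (f x a * g b d) + g a d * (f x a * g b c)"
    by (simp add: algebra_simps)
  also have "\<dots> = 0"
    by (simp add: rel X algebra_simps)
  finally show ?thesis using nz by simp
qed

text \<open>This is Lagrange interpolation with denominators cleared. Writing the left-hand side as
  \<open>(f x a * g b c) * (f x a * g b d) * g c d\<close> and expanding both brackets by the Jacobi
  identities produces the term in \<open>(f x b)\<^sup>2\<close>. The identity for \<open>b, c, d\<close> removes \<open>f x b\<close>
  from the mixed terms; apart from the two remaining squares this leaves \<open>f x c * f x d\<close>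
  times the Pluecker expression.\<close>

lemma quadratic_interpolation:
  fixes f g :: "complex \<Rightarrow> complex \<Rightarrow> complex"
  assumes perp: "jacobi_perp X f g"
    and anti: "\<And>u v. u \<in> X \<Longrightarrow> v \<in> X \<Longrightarrow> g u v = - g v u"
    and X: "x \<in> X" "a \<in> X" "b \<in> X" "c \<in> X" "d \<in> X"
    and nz: "f x a \<noteq> 0"
  shows "(f x a)\<^sup>2 * g b c * g b d * g c d
       = (f x b)\<^sup>2 * g a c * g a d * g c d
       - (f x c)\<^sup>2 * g a b * g a d * g b d
       + (f x d)\<^sup>2 * g a b * g a c * g b c"
proof -
  have rel: "f x u * g v w - f x v * g u w + f x w * g u v = 0"
    if "u \<in> X" "v \<in> X" "w \<in> X" for u v w
  proof -
    have "f x u * g v w + f x v * g w u + f x w * g u v = 0"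
      using perp X that unfolding jacobi_perp_def by blast
    moreover have "g w u = - g u w" using anti that by blast
    ultimately show ?thesis by simp
  qed
  have "f x a * g b c - f x b * g a c + f x c * g a b = 0"
    and "f x a * g b d - f x b * g a d + f x d * g a b = 0"
    and "f x b * g c d - f x c * g b d + f x d * g b c = 0"
    using rel X by blast+
  moreover have "g a b * g c d - g a c * g b d + g a d * g b c = 0"
    by (rule plucker_of_jacobi[OF perp anti X nz])
  ultimately show ?thesis by algebra
qed

text \<open>In this form the interpolation identity says that the coefficients of \<open>U (k - 1)\<close> in the
  two sums add up to one minus the factor by which \<open>U\<close> grows.\<close>

lemma telescoping_weights:
  fixes f g :: "complex \<Rightarrow> complex \<Rightarrow> complex"
  assumes perp: "jacobi_perp X f g"
    and anti: "\<And>u v. u \<in> X \<Longrightarrow> v \<in> X \<Longrightarrow> g u v = - g v u"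
    and X: "x \<in> X" "a \<in> X" "b \<in> X" "c \<in> X" "d \<in> X"
    and nz: "f x a \<noteq> 0" "g b c \<noteq> 0" "g b d \<noteq> 0" "g c d \<noteq> 0"
  shows "(f x d)\<^sup>2 * g a b * g a c / ((f x a)\<^sup>2 * g d b * g d c)
       + (f x c)\<^sup>2 * g a b * g a d / ((f x a)\<^sup>2 * g c b * g c d)
       = 1 - (f x b)\<^sup>2 * g a c * g a d / ((f x a)\<^sup>2 * g b c * g b d)"
proof -
  have flip: "g d b = - g b d" "g d c = - g c d" "g c b = - g b c"
    using anti X by blast+
  let ?P = "(f x a)\<^sup>2 * g b c * g b d * g c d"
  have "(f x d)\<^sup>2 * g a b * g a c / ((f x a)\<^sup>2 * g d b * g d c)
        = (f x d)\<^sup>2 * g a b * g a c * g b c / ?P"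
    and "(f x c)\<^sup>2 * g a b * g a d / ((f x a)\<^sup>2 * g c b * g c d)
        = - ((f x c)\<^sup>2 * g a b * g a d * g b d) / ?P"
    and "(f x b)\<^sup>2 * g a c * g a d / ((f x a)\<^sup>2 * g b c * g b d)
        = (f x b)\<^sup>2 * g a c * g a d * g c d / ?P"
    using nz by (simp_all add: flip mult.assoc)
  moreover have "1 = ((f x b)\<^sup>2 * g a c * g a d * g c d
       - (f x c)\<^sup>2 * g a b * g a d * g b d
       + (f x d)\<^sup>2 * g a b * g a c * g b c) / ?P"
    using nz by (simp flip: quadratic_interpolation[OF perp anti X nz(1)])
  ultimately show ?thesis
    by (simp only: add_divide_distrib diff_divide_distrib minus_divide_left [symmetric]) algebra
qed

theorem theorem1p3:
  fixes X :: "complex set"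
    and f g :: "complex \<Rightarrow> complex \<Rightarrow> complex"
    and x a b c d :: "nat \<Rightarrow> complex"
    and n :: nat
  assumes "jacobi_perp X f g"
    and "\<And>u v. u \<in> X \<Longrightarrow> v \<in> X \<Longrightarrow> g u v = - g v u"
    and "\<And>k. x k \<in> X" and "\<And>k. a k \<in> X" and "\<And>k. b k \<in> X"
    and "\<And>k. c k \<in> X" and "\<And>k. d k \<in> X"
    and "\<And>k. distinct [x k, a k, b k, c k, d k]"
    and "\<And>k. (f (x k) (a k))\<^sup>2 * g (b k) (c k) * g (b k) (d k) \<noteq> 0"
    and "\<And>k. k \<ge> 1 \<Longrightarrow> (f (x k) (a k))\<^sup>2 * g (d k) (b k) * g (d k) (c k) \<noteq> 0"
    and "\<And>k. k \<ge> 1 \<Longrightarrow> (f (x k) (a k))\<^sup>2 * g (c k) (b k) * g (c k) (d k) \<noteq> 0"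
  shows "T1 f g x a b c d n + T2 f g x a b c d n = U f g x a b c d 0 - U f g x a b c d n"
proof (induction n)
  case 0
  then show ?case by (simp add: T1_def T2_def)
next
  case (Suc n)
  let ?k = "Suc n"
  let ?D = "(f (x ?k) (d ?k))\<^sup>2 * g (a ?k) (b ?k) * g (a ?k) (c ?k)
            / ((f (x ?k) (a ?k))\<^sup>2 * g (d ?k) (b ?k) * g (d ?k) (c ?k))"
  let ?C = "(f (x ?k) (c ?k))\<^sup>2 * g (a ?k) (b ?k) * g (a ?k) (d ?k)
            / ((f (x ?k) (a ?k))\<^sup>2 * g (c ?k) (b ?k) * g (c ?k) (d ?k))"
  let ?B = "(f (x ?k) (b ?k))\<^sup>2 * g (a ?k) (c ?k) * g (a ?k) (d ?k)
            / ((f (x ?k) (a ?k))\<^sup>2 * g (b ?k) (c ?k) * g (b ?k) (d ?k))"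
  let ?U = "U f g x a b c d"
  have "f (x ?k) (a ?k) \<noteq> 0" "g (b ?k) (c ?k) \<noteq> 0" "g (b ?k) (d ?k) \<noteq> 0"
    using assms(9)[of ?k] by auto
  moreover have "g (c ?k) (d ?k) \<noteq> 0"
    using assms(11)[of ?k] by auto
  ultimately have weights: "?D + ?C = 1 - ?B"
    using telescoping_weights[OF assms(1,2)] assms(3-7) by blast
  have U_step: "?U ?k = ?B * ?U n"
    by (simp add: U_def mult.commute)
  have "T1 f g x a b c d ?k + T2 f g x a b c d ?k
      = (T1 f g x a b c d n + ?D * ?U n) + (T2 f g x a b c d n + ?C * ?U n)"
    by (simp add: T1_def T2_def)
  also have "\<dots> = (T1 f g x a b c d n + T2 f g x a b c d n) + (?D + ?C) * ?U n"
    by (simp only: distrib_right add.assoc add.commute add.left_commute)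
  also have "\<dots> = (?U 0 - ?U n) + (1 - ?B) * ?U n"
    by (simp only: Suc.IH weights)
  also have "\<dots> = ?U 0 - ?U ?k"
    unfolding U_step left_diff_distrib by simp
  finally show ?case .
qed

end
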